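(* Let $P$ be a 3-colorable convex polytope with $2n$ vertices, with a fixed proper coloring of its faces by $1,2,3$, let $m_i$ be the number of faces of $P$ colored by $i$ ($i=1,2,3$), and let $\widetilde{P}\subseteq\mathbb{R}^{2n}$ be the convex hull of the face-vertex incident vectors of $P$. Then $$\dim \widetilde{P}=\begin{cases} n-1, & \text{if } m_1=m_2=m_3;\\ n, & \text{otherwise.}\end{cases}$$
   Context: A convex polytope $P$ is 3-colorable (3-face-colorable) if it is 3-dimensional and simple (each vertex belongs to exactly three 2-dimensional faces) and each facet can be assigned a color in $\{1,2,3\}$ so that adjacent facets have different colors. "Face of $P$" here means 2-dimensional face (facet). Such a $P$ has an even number of vertices, written $2n$, and then $3n$ edges and $n+2$ faces. Fix an ordering of the vertex set $V(P)$, identifying it with $\{1,\dots,2n\}$. For a face $f$ of $P$, the face-vertex incident vector $\xi_f\in\{0,1\}^{2n}\subseteq\mathbb{R}^{2n}$ has entry $1$ at $v$ if $v\in f$ and $0$ otherwise. Let $S=\{\xi_f : f \text{ a face of } P\}$ and $\widetilde{P}=\operatorname{conv}(S)\subseteq\mathbb{R}^{2n}$. $\dim\widetilde P$ is the dimension of its affine hull. *)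

theory Defs
  imports "HOL-Analysis.Analysis"
begin

definition vertices :: "'a::euclidean_space set \<Rightarrow> 'a set" where
  "vertices P = {v. v extreme_point_of P}"

definition facets :: "'a::euclidean_space set \<Rightarrow> 'a set set" where
  "facets P = {f. f facet_of P}"

text \<open>A 3-dimensional convex polytope, in a Euclidean space of any dimension, each of whose
  vertices belongs to exactly three facets.\<close>

definition simple_3_polytope :: "'a::euclidean_space set \<Rightarrow> bool" where
  "simple_3_polytope P \<longleftrightarrow>
     polytope P \<and> aff_dim P = 3 \<and> (\<forall>v\<in>vertices P. card {f \<in> facets P. v \<in> f} = 3)"

definition adjacent_facets :: "'a::euclidean_space set \<Rightarrow> 'a set \<Rightarrow> 'a set \<Rightarrow> bool" where
  "adjacent_facets P f g \<longleftrightarrow>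
     f \<in> facets P \<and> g \<in> facets P \<and> f \<noteq> g \<and> (\<exists>e. e edge_of P \<and> e \<subseteq> f \<and> e \<subseteq> g)"

definition proper_3_coloring :: "'a::euclidean_space set \<Rightarrow> ('a set \<Rightarrow> nat) \<Rightarrow> bool" where
  "proper_3_coloring P c \<longleftrightarrow>
     (\<forall>f\<in>facets P. c f \<in> {1, 2, 3}) \<and> (\<forall>f g. adjacent_facets P f g \<longrightarrow> c f \<noteq> c g)"

definition three_colorable_polytope :: "'a::euclidean_space set \<Rightarrow> bool" where
  "three_colorable_polytope P \<longleftrightarrow> simple_3_polytope P \<and> (\<exists>c. proper_3_coloring P c)"

definition color_count :: "'a::euclidean_space set \<Rightarrow> ('a set \<Rightarrow> nat) \<Rightarrow> nat \<Rightarrow> nat" where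
  "color_count P c i = card {f \<in> facets P. c f = i}"

text \<open>The vertices are labelled by a finite index type: \<open>vtx\<close> is meant to be a bijection
  from \<open>UNIV :: 'v set\<close> onto \<open>vertices P\<close>, so that \<open>real ^ 'v\<close> plays the role of
  the real coordinate space with one coordinate per vertex.\<close>

definition incidence_vector :: "('v::finite \<Rightarrow> 'a) \<Rightarrow> 'a set \<Rightarrow> real ^ 'v" where
  "incidence_vector vtx f = (\<chi> i. if vtx i \<in> f then 1 else 0)"

definition incidence_polytope :: "'a::euclidean_space set \<Rightarrow> ('v::finite \<Rightarrow> 'a) \<Rightarrow> (real ^ 'v) set" where
  "incidence_polytope P vtx = convex hull (incidence_vector vtx ` facets P)"

end

theory Submission
  imports Defs
begin

text \<open>
  Every vertex of \<open>P\<close> lies on exactly one facet of each colour, because the three facets at a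
  simple vertex meet pairwise in edges and so are pairwise adjacent. The incidence vectors of the
  facets of one colour therefore add up to the all-ones vector, and comparing the three colours
  gives the relations \<open>\<Sum>f. a (c f) \<xi>\<^sub>f = 0\<close> with \<open>a 1 + a 2 + a 3 = 0\<close>.

  These are all the linear relations. If \<open>\<Sum>f. l f \<xi>\<^sub>f = 0\<close>, then the three coefficients at each
  vertex add up to zero. Two vertices joined by an edge share two facets, and their remaining
  facets have the same colour; so the coefficient of a colour is the same at both, and since the
  graph of \<open>P\<close> is connected, \<open>l\<close> depends on the colour only (\<open>relation_constant_on_colours\<close>). The
  relations form a plane, and the incidence vectors span a space of dimension \<open>card (facets P) - 2\<close>
  (\<open>dim_incidence_vectors\<close>).

  The number of facets is \<open>n + 2\<close>. Euler's formula would give this; here it comes from a linear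
  functional that separates the vertices, together with simplicity
  (\<open>card_facets_simple_3_polytope\<close>). At a simple vertex \<open>v\<close>, \<open>P\<close> lies in the cone spanned by the
  three edges at \<open>v\<close>, so the numbers of descending and ascending edges at \<open>v\<close> decide of which
  facets \<open>v\<close> is the highest or the lowest vertex. Each facet has one highest and one lowest vertex,
  and summing over the vertices counts the facets twice. The same functional supplies the
  connectedness: from every vertex except the highest one, some edge ascends.

  So the linear span has dimension \<open>n\<close>, and the affine dimension is \<open>n\<close> or \<open>n - 1\<close> according to
  whether the origin lies in the affine hull. It does iff some relation has a nonzero coefficient
  sum \<open>m\<^sub>1 a 1 + m\<^sub>2 a 2 + m\<^sub>3 a 3\<close>, where \<open>m\<^sub>i\<close> is the number of facets of colour \<open>i\<close>. This sum
  vanishes for all \<open>a\<close> with \<open>a 1 + a 2 + a 3 = 0\<close> exactly when \<open>m\<^sub>1 = m\<^sub>2 = m\<^sub>3\<close>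
  (\<open>zero_in_affine_hull_incidence_vectors\<close>).
\<close>

section \<open>Edges at a simple vertex\<close>

text \<open>The \<open>d\<^sub>i\<close> are, up to scaling, a basis dual to the functionals \<open>a\<^sub>i\<close>. This recovers the edge
  coordinates of a point of a simple polytope, as seen from a vertex, from the slacks of the three
  facet inequalities there.\<close>
lemma span_of_dual_triple:
  fixes a1 a2 a3 d1 d2 d3 :: "'a::euclidean_space"
  assumes "dim V \<le> 3" and d: "d1 \<in> V" "d2 \<in> V" "d3 \<in> V"
    and nz: "a1 \<bullet> d1 \<noteq> 0" "a2 \<bullet> d2 \<noteq> 0" "a3 \<bullet> d3 \<noteq> 0"
    and z: "a1 \<bullet> d2 = 0" "a1 \<bullet> d3 = 0" "a2 \<bullet> d1 = 0" "a2 \<bullet> d3 = 0" "a3 \<bullet> d1 = 0" "a3 \<bullet> d2 = 0"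
    and "x \<in> V"
  shows "x = (a1 \<bullet> x / (a1 \<bullet> d1)) *\<^sub>R d1 + (a2 \<bullet> x / (a2 \<bullet> d2)) *\<^sub>R d2 + (a3 \<bullet> x / (a3 \<bullet> d3)) *\<^sub>R d3"
proof -
  have ne: "d1 \<noteq> d2" "d1 \<noteq> d3" "d2 \<noteq> d3"
    using nz z by auto
  have "independent {d1, d2, d3}"
  proof (rule independent_if_scalars_zero)
    fix u y assume *: "(\<Sum>y\<in>{d1,d2,d3}. u y *\<^sub>R y) = 0" and y: "y \<in> {d1,d2,d3}"
    have eq: "u d1 *\<^sub>R d1 + u d2 *\<^sub>R d2 + u d3 *\<^sub>R d3 = 0"
      using * ne by (simp add: add.assoc)
    have "a1 \<bullet> (u d1 *\<^sub>R d1 + u d2 *\<^sub>R d2 + u d3 *\<^sub>R d3) = 0"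
      "a2 \<bullet> (u d1 *\<^sub>R d1 + u d2 *\<^sub>R d2 + u d3 *\<^sub>R d3) = 0"
      "a3 \<bullet> (u d1 *\<^sub>R d1 + u d2 *\<^sub>R d2 + u d3 *\<^sub>R d3) = 0"
      unfolding eq by simp_all
    then have "u d1 = 0" "u d2 = 0" "u d3 = 0"
      using nz z by (simp_all add: inner_add_right)
    then show "u y = 0" using y by auto
  qed simp
  then have "V \<subseteq> span {d1, d2, d3}"
    using d ne \<open>dim V \<le> 3\<close> by (intro card_ge_dim_independent) auto
  then have "x \<in> span {d1, d2, d3}" using \<open>x \<in> V\<close> by auto
  then obtain c1 c2 c3 where x: "x = c1 *\<^sub>R d1 + c2 *\<^sub>R d2 + c3 *\<^sub>R d3"
    by (auto simp: span_insert algebra_simps)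
  then have "a1 \<bullet> x = c1 * (a1 \<bullet> d1)" "a2 \<bullet> x = c2 * (a2 \<bullet> d2)" "a3 \<bullet> x = c3 * (a3 \<bullet> d3)"
    using z by (simp_all add: inner_add_right)
  then show ?thesis using nz x by simp
qed

lemma Inter_facets_at_vertex:
  assumes "polytope P" "v \<in> vertices P" "P \<noteq> {v}"
  shows "\<Inter>{f \<in> facets P. v \<in> f} = {v}"
proof -
  have "{v} face_of P" using assms by (simp add: face_of_singleton vertices_def)
  from face_of_polyhedron[OF polytope_imp_polyhedron[OF \<open>polytope P\<close>] this] assms(3)
  show ?thesis by (simp add: facets_def)
qed

text \<open>The intersection is a face of dimension at most 1, so the only other possibility is that the
  two facets meet in the vertex alone. Then the polygon \<open>f1\<close> could
  have only one side at \<open>v\<close>, its intersection with \<open>f3\<close>, whereas a vertex is the intersection of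
  the sides through it.\<close>
lemma edge_at_simple_vertex:
  fixes P :: "'a::euclidean_space set"
  assumes P: "polytope P" "aff_dim P = 3" and v: "v \<in> vertices P"
    and star: "{f \<in> facets P. v \<in> f} = {f1, f2, f3}" and dist: "distinct [f1, f2, f3]"
  shows "(f1 \<inter> f2) edge_of P"
proof -
  have f: "f face_of P" "v \<in> f" "aff_dim f = 2" if "f \<in> {f1, f2, f3}" for f
  proof -
    have "f \<in> {f \<in> facets P. v \<in> f}" using that unfolding star .
    then show "f face_of P" "v \<in> f" "aff_dim f = 2"
      using P(2) by (auto simp: facets_def facet_of_def)
  qed
  have polyf: "polytope f" if "f \<in> {f1, f2, f3}" for f
    by (rule face_of_polytope_polytope[OF P(1) f(1)[OF that]])
  have lt: "aff_dim (f1 \<inter> g) < 2" "f1 \<inter> g face_of f1" if "g \<in> {f2, f3}" for g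
  proof -
    have g: "g face_of P" "f1 face_of P" using f(1)[of g] f(1)[of f1] that by auto
    then have face: "f1 \<inter> g face_of f1" "f1 \<inter> g face_of g"
      by (meson face_of_Int face_of_face inf_le1 inf_le2)+
    have "f1 \<inter> g \<noteq> f1"
    proof
      assume eq: "f1 \<inter> g = f1"
      have "convex g" using g face_of_imp_convex by blast
      with eq face face_of_aff_dim_lt[of g f1] f(3)[of f1] f(3)[of g] that dist show False by auto
    qed
    then show "aff_dim (f1 \<inter> g) < 2" "f1 \<inter> g face_of f1"
      using face face_of_aff_dim_lt[of f1 "f1 \<inter> g"] f(3)[of f1] f(1)[of f1] face_of_imp_convex by auto
  qed
  have vf1: "v \<in> vertices f1" "f1 \<noteq> {v}"
    using f[of f1] v by (auto simp: vertices_def extreme_point_of_face)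
  have "f1 \<inter> f2 \<noteq> {v}"
  proof
    assume triv: "f1 \<inter> f2 = {v}"
    \<comment> \<open>A side of \<open>f1\<close> is a proper face of \<open>P\<close>, hence an intersection of facets of \<open>P\<close>; these
      cannot be \<open>f1\<close> alone.\<close>
    have side: "e = f1 \<inter> f3" if "e \<in> facets f1" "v \<in> e" for e
    proof -
      have e: "e face_of f1" "aff_dim e = 1"
        using that f(3)[of f1] by (auto simp: facets_def facet_of_def)
      have eP: "e face_of P" using e f(1)[of f1] face_of_trans by blast
      have enP: "e \<noteq> P" "e \<noteq> {}" using e P by auto
      define G where "G = {g. g facet_of P \<and> e \<subseteq> g}"
      have Inter: "e = \<Inter>G"
        using face_of_polyhedron[OF polytope_imp_polyhedron[OF P(1)] eP] enP by (simp add: G_def)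
      have "G \<subseteq> {f1, f2, f3}"
        using star that(2) by (auto simp: facets_def G_def)
      moreover have "f1 \<in> G"
        using star face_of_imp_subset[OF e(1)] by (auto simp: G_def facets_def)
      moreover have "G \<noteq> {f1}" using Inter e f(3)[of f1] by auto
      moreover have "f2 \<notin> G"
      proof
        assume "f2 \<in> G"
        then have "e \<subseteq> {v}" using face_of_imp_subset[OF e(1)] triv by (auto simp: G_def)
        then have "e = {v}" using that(2) by auto
        then show False using e(2) by simp
      qed
      ultimately have "f3 \<in> G" by auto
      then have "e \<subseteq> f3" by (simp add: G_def)
      then have sub: "e \<subseteq> f1 \<inter> f3" using face_of_imp_subset[OF e(1)] by auto
      then have "e face_of (f1 \<inter> f3)" using e(1) face_of_subset by blast
      moreover have "convex (f1 \<inter> f3)" using lt(2)[of f3] face_of_imp_convex by auto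
      ultimately show ?thesis
        using face_of_aff_dim_lt[of "f1 \<inter> f3" e] lt(1)[of f3] e(2) by fastforce
    qed
    have Inter: "\<Inter>{e \<in> facets f1. v \<in> e} = {v}"
      using Inter_facets_at_vertex[OF polyf vf1] by simp
    have "{e \<in> facets f1. v \<in> e} \<noteq> {}"
    proof
      assume none: "{e \<in> facets f1. v \<in> e} = {}"
      have "(UNIV :: 'a set) = {v}" using Inter unfolding none by simp
      then show False using vf1(2) f(2)[of f1] by auto
    qed
    moreover have "{e \<in> facets f1. v \<in> e} \<subseteq> {f1 \<inter> f3}"
    proof
      fix g assume "g \<in> {e \<in> facets f1. v \<in> e}"
      then have "g \<in> facets f1" "v \<in> g" by auto
      from side[OF this] show "g \<in> {f1 \<inter> f3}" by simp
    qed
    ultimately have sides: "{e \<in> facets f1. v \<in> e} = {f1 \<inter> f3}"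
      by (simp only: subset_singleton_iff simp_thms)
    then have "f1 \<inter> f3 \<in> facets f1" by blast
    moreover have "f1 \<inter> f3 = {v}" using Inter unfolding sides by simp
    ultimately show False
      using f(3)[of f1] by (simp add: facets_def facet_of_def)
  qed
  moreover have "v \<in> f1 \<inter> f2" using f(2)[of f1] f(2)[of f2] by auto
  ultimately have "f1 \<inter> f2 \<noteq> {}" "\<nexists>a. f1 \<inter> f2 = {a}" by (metis empty_iff, metis singletonD)
  then have "aff_dim (f1 \<inter> f2) \<noteq> -1" "aff_dim (f1 \<inter> f2) \<noteq> 0"
    using aff_dim_empty[of "f1 \<inter> f2"] aff_dim_eq_0[of "f1 \<inter> f2"] by (metis, metis)
  moreover have "aff_dim (f1 \<inter> f2) \<ge> -1" by (rule aff_dim_geq)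
  ultimately have "aff_dim (f1 \<inter> f2) = 1" using lt(1)[of f2] by auto
  then show ?thesis
    using f(1)[of f1] f(1)[of f2] by (auto simp: edge_of_def face_of_Int)
qed

lemma neighbour_at_simple_vertex:
  fixes P :: "'a::euclidean_space set"
  assumes P: "polytope P" "aff_dim P = 3" and v: "v \<in> vertices P"
    and star: "{f \<in> facets P. v \<in> f} = {f1, f2, f3}" and dist: "distinct [f1, f2, f3]"
  obtains w where "w \<in> vertices P" "w \<in> f1" "w \<in> f2" "w \<notin> f3"
proof -
  have edge: "(f1 \<inter> f2) face_of P" "aff_dim (f1 \<inter> f2) = 1"
    using edge_at_simple_vertex[OF assms] by (auto simp: edge_of_def)
  have "compact (f1 \<inter> f2)" "convex (f1 \<inter> f2)"
    using edge(1) P(1) face_of_polytope_polytope polytope_imp_compact polytope_imp_convex by blast+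
  then have hull: "f1 \<inter> f2 = convex hull (vertices (f1 \<inter> f2))"
    unfolding vertices_def by (rule Krein_Milman_Minkowski)
  have "\<not> vertices (f1 \<inter> f2) \<subseteq> {v}"
  proof
    assume "vertices (f1 \<inter> f2) \<subseteq> {v}"
    then have "convex hull (vertices (f1 \<inter> f2)) \<subseteq> {v}" by (rule hull_minimal) simp
    then have "f1 \<inter> f2 \<subseteq> {v}" using hull by simp
    then show False using edge(2) aff_dim_subset[of "f1 \<inter> f2" "{v}"] by simp
  qed
  then obtain w where w: "w \<in> vertices (f1 \<inter> f2)" "w \<noteq> v" by auto
  then have w': "w \<in> vertices P" "w \<in> f1 \<inter> f2"
    using extreme_point_of_face[OF edge(1)] by (auto simp: vertices_def)
  have "P \<noteq> {v}" using P(2) by auto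
  then have "f1 \<inter> f2 \<inter> f3 = {v}"
    using Inter_facets_at_vertex[OF P(1) v] star by (simp add: Int_assoc)
  then have "w \<notin> f3" using w' w(2) by auto
  then show ?thesis using that w' by auto
qed

text \<open>The local picture at a simple vertex \<open>v\<close>: \<open>w\<^sub>i\<close> is the neighbour of \<open>v\<close> along the edge that is
  opposite to the facet \<open>f\<^sub>i\<close>, and \<open>P\<close> lies in the cone at \<open>v\<close> whose rays point to the neighbours.
  A point on \<open>f\<^sub>i\<close> uses only the two edges of \<open>f\<^sub>i\<close>.\<close>
definition vertex_frame ::
    "'a::euclidean_space set \<Rightarrow> 'a \<Rightarrow> 'a set \<Rightarrow> 'a set \<Rightarrow> 'a set \<Rightarrow> 'a \<Rightarrow> 'a \<Rightarrow> 'a \<Rightarrow> bool" where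
  "vertex_frame P v f1 f2 f3 w1 w2 w3 \<longleftrightarrow>
     {f \<in> facets P. v \<in> f} = {f1, f2, f3} \<and> distinct [f1, f2, f3] \<and>
     {w1, w2, w3} \<subseteq> vertices P \<and>
     w1 \<in> f2 \<inter> f3 - f1 \<and> w2 \<in> f1 \<inter> f3 - f2 \<and> w3 \<in> f1 \<inter> f2 - f3 \<and>
     (\<forall>x\<in>P. \<exists>s1\<ge>0. \<exists>s2\<ge>0. \<exists>s3\<ge>0.
        x - v = s1 *\<^sub>R (w1 - v) + s2 *\<^sub>R (w2 - v) + s3 *\<^sub>R (w3 - v) \<and>
        (x \<in> f1 \<longrightarrow> s1 = 0) \<and> (x \<in> f2 \<longrightarrow> s2 = 0) \<and> (x \<in> f3 \<longrightarrow> s3 = 0))"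

lemma vertex_frame_cone:
  assumes "vertex_frame P v f1 f2 f3 w1 w2 w3" "x \<in> P"
  shows "\<exists>s1\<ge>0. \<exists>s2\<ge>0. \<exists>s3\<ge>0.
      x - v = s1 *\<^sub>R (w1 - v) + s2 *\<^sub>R (w2 - v) + s3 *\<^sub>R (w3 - v) \<and>
      (x \<in> f1 \<longrightarrow> s1 = 0) \<and> (x \<in> f2 \<longrightarrow> s2 = 0) \<and> (x \<in> f3 \<longrightarrow> s3 = 0)"
  using assms unfolding vertex_frame_def by (elim conjE) (rule bspec)

text \<open>By this symmetry, statements about a frame need to be shown for its first facet only.\<close>
lemma vertex_frame_rotate:
  "vertex_frame P v f1 f2 f3 w1 w2 w3 \<Longrightarrow> vertex_frame P v f2 f3 f1 w2 w3 w1"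
proof -
  assume frame: "vertex_frame P v f1 f2 f3 w1 w2 w3"
  have "\<exists>s2\<ge>0. \<exists>s3\<ge>0. \<exists>s1\<ge>0.
      x - v = s2 *\<^sub>R (w2 - v) + s3 *\<^sub>R (w3 - v) + s1 *\<^sub>R (w1 - v) \<and>
      (x \<in> f2 \<longrightarrow> s2 = 0) \<and> (x \<in> f3 \<longrightarrow> s3 = 0) \<and> (x \<in> f1 \<longrightarrow> s1 = 0)" if x: "x \<in> P" for x
  proof -
    obtain s1 s2 s3 where "s1 \<ge> 0" "s2 \<ge> 0" "s3 \<ge> 0"
      "x - v = s1 *\<^sub>R (w1 - v) + s2 *\<^sub>R (w2 - v) + s3 *\<^sub>R (w3 - v)"
      "x \<in> f1 \<longrightarrow> s1 = 0" "x \<in> f2 \<longrightarrow> s2 = 0" "x \<in> f3 \<longrightarrow> s3 = 0"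
      using vertex_frame_cone[OF frame x] by (elim exE conjE) (rule that; assumption)
    then show ?thesis
      by (intro exI[of _ s2] exI[of _ s3] exI[of _ s1] conjI) (simp_all add: add.assoc add.left_commute)
  qed
  moreover have "{f2, f3, f1} = {f1, f2, f3}" "{w2, w3, w1} = {w1, w2, w3}" by auto
  moreover have "f2 \<noteq> f1" "f3 \<noteq> f1" using frame by (auto simp: vertex_frame_def)
  ultimately show ?thesis
    using frame unfolding vertex_frame_def by (simp add: Int_commute)
qed

text \<open>The inequality of each facet vanishes on two of the edge directions and is strict on the
  third, so the three edge directions form a basis dual to the facet inequalities. The
  coordinates of a point in this basis are ratios of slacks of equal sign.\<close>
lemma vertex_frame_exists:
  fixes P :: "'a::euclidean_space set"
  assumes P: "simple_3_polytope P" and v: "v \<in> vertices P"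
  obtains f1 f2 f3 w1 w2 w3 where "vertex_frame P v f1 f2 f3 w1 w2 w3"
proof -
  have poly: "polytope P" "aff_dim P = 3" and "card {f \<in> facets P. v \<in> f} = 3"
    using P v by (auto simp: simple_3_polytope_def)
  then obtain f1 f2 f3 where star: "{f \<in> facets P. v \<in> f} = {f1, f2, f3}"
    and dist: "f1 \<noteq> f2" "f2 \<noteq> f3" "f1 \<noteq> f3"
    by (auto simp: card_3_iff)
  have "{f \<in> facets P. v \<in> f} = {f2, f3, f1}" unfolding star by auto
  then obtain w1 where w1: "w1 \<in> vertices P" "w1 \<in> f2 \<inter> f3 - f1"
    using dist by (elim neighbour_at_simple_vertex[OF poly v]) auto
  have "{f \<in> facets P. v \<in> f} = {f1, f3, f2}" unfolding star by auto
  then obtain w2 where w2: "w2 \<in> vertices P" "w2 \<in> f1 \<inter> f3 - f2"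
    using dist by (elim neighbour_at_simple_vertex[OF poly v]) auto
  have "{f \<in> facets P. v \<in> f} = {f1, f2, f3}" unfolding star by auto
  then obtain w3 where w3: "w3 \<in> vertices P" "w3 \<in> f1 \<inter> f2 - f3"
    using dist by (elim neighbour_at_simple_vertex[OF poly v]) auto
  have sub: "vertices P \<subseteq> P" by (auto simp: vertices_def extreme_point_of_def)
  have inP: "w1 \<in> P" "w2 \<in> P" "w3 \<in> P" "v \<in> P" using w1 w2 w3 v sub by auto
  have halfspace: "\<exists>a. \<forall>x\<in>P. a \<bullet> (x - v) \<le> 0 \<and> (a \<bullet> (x - v) = 0 \<longleftrightarrow> x \<in> f)"
    if "f \<in> {f1, f2, f3}" for f
  proof -
    have f: "f facet_of P" "v \<in> f" using that star by (auto simp: facets_def)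
    obtain a b where ab: "P \<subseteq> {x. a \<bullet> x \<le> b}" "f = P \<inter> {x. a \<bullet> x = b}"
      using facet_of_polyhedron[OF polytope_imp_polyhedron[OF poly(1)] f(1)] by metis
    then have "a \<bullet> v = b" using f(2) by auto
    then show ?thesis using ab by (intro exI[of _ a]) (auto simp: inner_diff_right)
  qed
  obtain a1 where a1: "\<forall>x\<in>P. a1 \<bullet> (x - v) \<le> 0 \<and> (a1 \<bullet> (x - v) = 0 \<longleftrightarrow> x \<in> f1)"
    using halfspace[of f1] by auto
  obtain a2 where a2: "\<forall>x\<in>P. a2 \<bullet> (x - v) \<le> 0 \<and> (a2 \<bullet> (x - v) = 0 \<longleftrightarrow> x \<in> f2)"
    using halfspace[of f2] by auto
  obtain a3 where a3: "\<forall>x\<in>P. a3 \<bullet> (x - v) \<le> 0 \<and> (a3 \<bullet> (x - v) = 0 \<longleftrightarrow> x \<in> f3)"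
    using halfspace[of f3] by auto
  have neg: "a1 \<bullet> (w1 - v) < 0" "a2 \<bullet> (w2 - v) < 0" "a3 \<bullet> (w3 - v) < 0"
    using a1 a2 a3 w1(2) w2(2) w3(2) inP by (meson DiffD2 less_eq_real_def)+
  have zero: "a1 \<bullet> (w2 - v) = 0" "a1 \<bullet> (w3 - v) = 0" "a2 \<bullet> (w1 - v) = 0"
    "a2 \<bullet> (w3 - v) = 0" "a3 \<bullet> (w1 - v) = 0" "a3 \<bullet> (w2 - v) = 0"
    using a1 a2 a3 w1(2) w2(2) w3(2) inP by (meson DiffD1 IntD1 IntD2)+
  have "int (dim ((\<lambda>x. x - v) ` P)) = 3"
    using aff_dim_eq_dim_subtract[of v P] poly(2) hull_inc[OF inP(4)] by metis
  then have dim: "dim ((\<lambda>x. x - v) ` P) \<le> 3" by simp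
  have cone: "\<exists>s1\<ge>0. \<exists>s2\<ge>0. \<exists>s3\<ge>0.
      x - v = s1 *\<^sub>R (w1 - v) + s2 *\<^sub>R (w2 - v) + s3 *\<^sub>R (w3 - v) \<and>
      (x \<in> f1 \<longrightarrow> s1 = 0) \<and> (x \<in> f2 \<longrightarrow> s2 = 0) \<and> (x \<in> f3 \<longrightarrow> s3 = 0)" if x: "x \<in> P" for x
  proof (intro exI conjI)
    show "x - v = (a1 \<bullet> (x - v) / (a1 \<bullet> (w1 - v))) *\<^sub>R (w1 - v)
        + (a2 \<bullet> (x - v) / (a2 \<bullet> (w2 - v))) *\<^sub>R (w2 - v)
        + (a3 \<bullet> (x - v) / (a3 \<bullet> (w3 - v))) *\<^sub>R (w3 - v)"
      using neg by (intro span_of_dual_triple[OF dim]) (auto simp: zero inP x)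
  qed (use a1 a2 a3 x neg in \<open>auto simp: divide_nonpos_neg\<close>)
  have "vertex_frame P v f1 f2 f3 w1 w2 w3"
    unfolding vertex_frame_def using star dist w1 w2 w3 cone by simp
  then show ?thesis by (rule that)
qed

section \<open>Counting the facets\<close>

text \<open>If \<open>y\<close> is orthogonal to a new vector \<open>d\<close>, tilt it towards \<open>d\<close>; only finitely many tilts make
  it orthogonal to one of the given vectors.\<close>
lemma generic_direction:
  fixes D :: "'a::euclidean_space set"
  assumes "finite D" "0 \<notin> D"
  shows "\<exists>y. \<forall>d\<in>D. y \<bullet> d \<noteq> 0"
  using assms
proof (induction D)
  case (insert d D)
  then obtain y where y: "\<forall>e\<in>D. y \<bullet> e \<noteq> 0" by auto
  have "finite ((\<lambda>e. - (y \<bullet> e) / (d \<bullet> e)) ` insert d D)" using insert by simp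
  then obtain t where t: "t \<notin> (\<lambda>e. - (y \<bullet> e) / (d \<bullet> e)) ` insert d D"
    using ex_new_if_finite[OF infinite_UNIV_char_0] by blast
  have "(y + t *\<^sub>R d) \<bullet> e \<noteq> 0" if e: "e \<in> insert d D" for e
  proof (cases "d \<bullet> e = 0")
    case True
    then have "e \<in> D" using e insert.prems by auto
    with True y show ?thesis by (simp add: inner_add_left)
  next
    case False
    have "t \<noteq> - (y \<bullet> e) / (d \<bullet> e)" using t e by blast
    with False show ?thesis by (auto simp: inner_add_left field_simps add_eq_0_iff)
  qed
  then show ?case by blast
qed simp

definition top_of :: "'a::euclidean_space \<Rightarrow> 'a set \<Rightarrow> 'a \<Rightarrow> bool" where
  "top_of y Q v \<longleftrightarrow> v \<in> Q \<and> (\<forall>x\<in>Q. y \<bullet> x \<le> y \<bullet> v)"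

text \<open>The points of \<open>Q\<close> of maximal height form a face of \<open>Q\<close>, which has an extreme point.\<close>
lemma card_top_vertices:
  assumes "polytope P" "Q face_of P" "Q \<noteq> {}" and inj: "inj_on ((\<bullet>) y) (vertices P)"
  shows "card {v \<in> vertices P. top_of y Q v} = 1"
proof -
  have Q: "compact Q" "convex Q"
    using assms face_of_polytope_polytope polytope_imp_compact polytope_imp_convex by blast+
  obtain m where m: "m \<in> Q" "\<forall>x\<in>Q. y \<bullet> x \<le> y \<bullet> m"
    using continuous_attains_sup[OF Q(1) assms(3) continuous_on_inner[OF continuous_on_const continuous_on_id]]
    by blast
  have face: "Q \<inter> {x. y \<bullet> x = y \<bullet> m} face_of Q"
    using m by (intro face_of_Int_supporting_hyperplane_le Q) auto
  moreover have "compact (Q \<inter> {x. y \<bullet> x = y \<bullet> m})"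
    by (intro compact_Int_closed Q closed_hyperplane)
  moreover have "convex (Q \<inter> {x. y \<bullet> x = y \<bullet> m})" using face face_of_imp_convex by blast
  ultimately obtain v where "v extreme_point_of (Q \<inter> {x. y \<bullet> x = y \<bullet> m})"
    using extreme_point_exists_convex[of "Q \<inter> {x. y \<bullet> x = y \<bullet> m}"] m by blast
  then have v: "v \<in> vertices P" "v \<in> Q" "y \<bullet> v = y \<bullet> m"
    using extreme_point_of_face[OF face] extreme_point_of_face[OF assms(2)] by (auto simp: vertices_def)
  have "top_of y Q v" using v m by (simp add: top_of_def)
  moreover have "u = v" if "u \<in> vertices P" "top_of y Q u" for u
  proof -
    have "y \<bullet> u = y \<bullet> v"
      using that(2) \<open>top_of y Q v\<close> by (intro antisym) (simp_all add: top_of_def)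
    then show ?thesis using inj that(1) v(1) by (simp add: inj_on_def)
  qed
  ultimately have "{v \<in> vertices P. top_of y Q v} = {v}"
    using v(1) by blast
  then show ?thesis by simp
qed

text \<open>Local maxima are global, because \<open>P\<close> and its facets lie in the cones spanned by their edges at
  \<open>v\<close>.\<close>
lemma top_of_frame:
  assumes frame: "vertex_frame P v f1 f2 f3 w1 w2 w3" and v: "v \<in> vertices P"
    and inj: "inj_on ((\<bullet>) y) (vertices P)"
  shows "top_of y f1 v \<longleftrightarrow> y \<bullet> w2 < y \<bullet> v \<and> y \<bullet> w3 < y \<bullet> v"
    and "top_of y P v \<longleftrightarrow> y \<bullet> w1 < y \<bullet> v \<and> y \<bullet> w2 < y \<bullet> v \<and> y \<bullet> w3 < y \<bullet> v"
proof -
  note fr = frame[unfolded vertex_frame_def]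
  have "f1 \<in> {f \<in> facets P. v \<in> f}" "f2 \<in> {f \<in> facets P. v \<in> f}" "f3 \<in> {f \<in> facets P. v \<in> f}"
    using fr by auto
  then have f: "f1 \<subseteq> P" "v \<in> f1" "v \<in> f2" "v \<in> f3"
    using facet_of_imp_subset by (auto simp: facets_def)
  have w: "{w1, w2, w3} \<subseteq> vertices P" "w2 \<in> f1" "w3 \<in> f1" "w1 \<noteq> v" "w2 \<noteq> v" "w3 \<noteq> v"
    using fr f by auto
  have sub: "vertices P \<subseteq> P" by (auto simp: vertices_def extreme_point_of_def)
  have strict: "y \<bullet> w < y \<bullet> v" if "y \<bullet> w \<le> y \<bullet> v" "w \<in> {w1, w2, w3}" for w
    using that w inj v unfolding inj_on_def by (metis insertE less_eq_real_def singletonD subsetD)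
  have cone: "y \<bullet> x \<le> y \<bullet> v"
    if x: "x \<in> P" and low: "y \<bullet> w2 < y \<bullet> v" "y \<bullet> w3 < y \<bullet> v" "x \<in> f1 \<or> y \<bullet> w1 < y \<bullet> v" for x
  proof -
    obtain s1 s2 s3 where s: "s1 \<ge> 0" "s2 \<ge> 0" "s3 \<ge> 0" "x \<in> f1 \<longrightarrow> s1 = 0"
      "x - v = s1 *\<^sub>R (w1 - v) + s2 *\<^sub>R (w2 - v) + s3 *\<^sub>R (w3 - v)"
      using vertex_frame_cone[OF frame x] by (elim exE conjE) (rule that; assumption)
    have "y \<bullet> x - y \<bullet> v = y \<bullet> (x - v)" by (simp add: inner_diff_right)
    also have "\<dots> = s1 * (y \<bullet> w1 - y \<bullet> v) + s2 * (y \<bullet> w2 - y \<bullet> v) + s3 * (y \<bullet> w3 - y \<bullet> v)"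
      unfolding s(5) by (simp add: inner_add_right inner_diff_right)
    also have "\<dots> \<le> 0"
    proof -
      have "s1 * (y \<bullet> w1 - y \<bullet> v) \<le> 0"
        using s(1,4) low(3) by (auto simp: mult_nonneg_nonpos)
      moreover have "s2 * (y \<bullet> w2 - y \<bullet> v) \<le> 0" "s3 * (y \<bullet> w3 - y \<bullet> v) \<le> 0"
        using s(2,3) low(1,2) by (auto simp: mult_nonneg_nonpos)
      ultimately show ?thesis by linarith
    qed
    finally show ?thesis by simp
  qed
  show "top_of y f1 v \<longleftrightarrow> y \<bullet> w2 < y \<bullet> v \<and> y \<bullet> w3 < y \<bullet> v"
    unfolding top_of_def using strict[of w2] strict[of w3] cone w f by blast
  show "top_of y P v \<longleftrightarrow> y \<bullet> w1 < y \<bullet> v \<and> y \<bullet> w2 < y \<bullet> v \<and> y \<bullet> w3 < y \<bullet> v"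
    unfolding top_of_def using strict[of w1] strict[of w2] strict[of w3] cone w f sub by blast
qed

text \<open>A facet has \<open>v\<close> as its highest (lowest) vertex iff its two edges at \<open>v\<close> descend (ascend). If
  \<open>k\<close> of the three edges descend, the two cardinalities are \<open>k choose 2\<close> and \<open>(3 - k) choose 2\<close>, so their
  sum is \<open>1\<close> for \<open>0 < k < 3\<close> and \<open>3\<close> at the two extremal vertices of \<open>P\<close>.\<close>
lemma card_facets_top_or_bottom_at_vertex:
  assumes P: "simple_3_polytope P" and v: "v \<in> vertices P"
    and inj: "inj_on ((\<bullet>) y) (vertices P)"
  shows "card {f \<in> facets P. top_of y f v} + card {f \<in> facets P. top_of (- y) f v}
    = 1 + 2 * of_bool (top_of y P v) + 2 * of_bool (top_of (- y) P v)"
proof -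
  obtain f1 f2 f3 w1 w2 w3 where fr1: "vertex_frame P v f1 f2 f3 w1 w2 w3"
    using vertex_frame_exists[OF P v] .
  note fr2 = vertex_frame_rotate[OF fr1]
  note fr3 = vertex_frame_rotate[OF fr2]
  have inj': "inj_on ((\<bullet>) (- y)) (vertices P)" using inj by (simp add: inj_on_def)
  have dist: "f1 \<noteq> f2" "f2 \<noteq> f3" "f1 \<noteq> f3" using fr1 by (auto simp: vertex_frame_def)
  have ne: "y \<bullet> w \<noteq> y \<bullet> v" if "w \<in> {w1, w2, w3}" for w
  proof -
    have "f1 \<in> {f \<in> facets P. v \<in> f}" "f2 \<in> {f \<in> facets P. v \<in> f}" "f3 \<in> {f \<in> facets P. v \<in> f}"
      using fr1 by (auto simp: vertex_frame_def)
    then have "w \<noteq> v" "w \<in> vertices P" using that fr1 by (auto simp: vertex_frame_def)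
    then show ?thesis using inj v by (auto simp: inj_on_def)
  qed
  have eq: "{f \<in> facets P. top_of z f v} = (if top_of z f1 v then {f1} else {}) \<union>
      (if top_of z f2 v then {f2} else {}) \<union> (if top_of z f3 v then {f3} else {})" for z
  proof -
    have "{f \<in> facets P. top_of z f v} = {f \<in> {f \<in> facets P. v \<in> f}. top_of z f v}"
      by (auto simp: top_of_def)
    also have "{f \<in> facets P. v \<in> f} = {f1, f2, f3}" using fr1 by (simp add: vertex_frame_def)
    finally show ?thesis by auto
  qed
  note top = top_of_frame[OF fr1 v inj] top_of_frame(1)[OF fr2 v inj] top_of_frame(1)[OF fr3 v inj]
    top_of_frame[OF fr1 v inj'] top_of_frame(1)[OF fr2 v inj'] top_of_frame(1)[OF fr3 v inj']
  show ?thesis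
    using dist ne[of w1] ne[of w2] ne[of w3] unfolding eq top
    by (cases "y \<bullet> w1 < y \<bullet> v"; cases "y \<bullet> w2 < y \<bullet> v"; cases "y \<bullet> w3 < y \<bullet> v") auto
qed

lemma finite_vertices: "polytope P \<Longrightarrow> finite (vertices P)"
  unfolding vertices_def using finite_polyhedron_extreme_points polytope_imp_polyhedron by blast

lemma finite_facets: "polytope P \<Longrightarrow> finite (facets P)"
  unfolding facets_def by (rule finite_polytope_facets)

lemma generic_direction_on_vertices:
  assumes "polytope P"
  obtains y where "inj_on ((\<bullet>) y) (vertices P)"
proof -
  let ?D = "(\<lambda>(u, v). u - v) ` (vertices P \<times> vertices P) - {0}"
  have "finite ?D" using finite_vertices[OF assms] by simp
  then obtain y where y: "\<forall>d\<in>?D. y \<bullet> d \<noteq> 0" using generic_direction[of ?D] by auto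
  have "inj_on ((\<bullet>) y) (vertices P)"
  proof (rule inj_onI, rule ccontr)
    fix u v assume *: "u \<in> vertices P" "v \<in> vertices P" "y \<bullet> u = y \<bullet> v" "u \<noteq> v"
    then have "u - v \<in> ?D" by force
    then have "y \<bullet> (u - v) \<noteq> 0" using y by (rule bspec[rotated])
    with * show False by (simp add: inner_diff_right)
  qed
  then show ?thesis by (rule that)
qed

text \<open>Each facet is counted once at its highest and once at its lowest vertex; the highest and the
  lowest vertex of \<open>P\<close> contribute the extra \<open>2 + 2\<close>.\<close>
lemma card_facets_simple_3_polytope:
  assumes P: "simple_3_polytope P"
  shows "2 * card (facets P) = card (vertices P) + 4"
proof -
  have poly: "polytope P" "aff_dim P = 3" using P by (auto simp: simple_3_polytope_def)
  obtain y where inj: "inj_on ((\<bullet>) y) (vertices P)"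
    using generic_direction_on_vertices[OF poly(1)] .
  then have inj': "inj_on ((\<bullet>) (- y)) (vertices P)" by (simp add: inj_on_def)
  note fin = finite_vertices[OF poly(1)] finite_facets[OF poly(1)]
  have P_face: "P face_of P" "P \<noteq> {}"
    using poly face_of_refl polytope_imp_convex by auto
  have facets: "(\<Sum>v\<in>vertices P. card {f \<in> facets P. top_of z f v}) = card (facets P)"
    if "inj_on ((\<bullet>) z) (vertices P)" for z
  proof -
    have "\<forall>f\<in>facets P. card {v \<in> vertices P. top_of z f v} = 1"
      using card_top_vertices[OF poly(1) _ _ that]
      by (auto simp: facets_def facet_of_def)
    then show ?thesis using sum_multicount[OF fin, of "\<lambda>v f. top_of z f v" 1] by simp
  qed
  have whole: "(\<Sum>v\<in>vertices P. of_bool (top_of z P v)) = (1::nat)"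
    if "inj_on ((\<bullet>) z) (vertices P)" for z
    using card_top_vertices[OF poly(1) P_face that] fin(1)
    by (simp add: sum_of_bool_eq Collect_conj_eq)
  have "2 * card (facets P) = (\<Sum>v\<in>vertices P. card {f \<in> facets P. top_of y f v}
      + card {f \<in> facets P. top_of (- y) f v})"
    by (simp add: sum.distrib facets[OF inj] facets[OF inj'])
  also have "\<dots> = (\<Sum>v\<in>vertices P. 1 + 2 * of_bool (top_of y P v) + 2 * of_bool (top_of (- y) P v))"
    by (intro sum.cong card_facets_top_or_bottom_at_vertex P inj) auto
  also have "\<dots> = card (vertices P) + 4"
    by (simp only: sum.distrib sum_distrib_left[symmetric] whole[OF inj] whole[OF inj']) simp
  finally show ?thesis .
qed

section \<open>Linear relations between incidence vectors\<close>

lemma colours_at_vertex: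
  assumes P: "simple_3_polytope P" and c: "proper_3_coloring P c" and v: "v \<in> vertices P"
    and star: "{f \<in> facets P. v \<in> f} = {f1, f2, f3}" and dist: "distinct [f1, f2, f3]"
  shows "distinct [c f1, c f2, c f3]" "{c f1, c f2, c f3} \<subseteq> {1, 2, 3}"
proof -
  have poly: "polytope P" "aff_dim P = 3" using P by (auto simp: simple_3_polytope_def)
  have facets: "f1 \<in> facets P" "f2 \<in> facets P" "f3 \<in> facets P" using star by auto
  have perm: "{f \<in> facets P. v \<in> f} = {f1, f3, f2}" "{f \<in> facets P. v \<in> f} = {f2, f3, f1}"
    unfolding star by auto
  have "(f1 \<inter> f2) edge_of P" "(f1 \<inter> f3) edge_of P" "(f2 \<inter> f3) edge_of P"
    using edge_at_simple_vertex[OF poly v star] edge_at_simple_vertex[OF poly v perm(1)]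
      edge_at_simple_vertex[OF poly v perm(2)] dist by auto
  then have "adjacent_facets P f1 f2" "adjacent_facets P f1 f3" "adjacent_facets P f2 f3"
    using facets dist unfolding adjacent_facets_def by auto
  then show "distinct [c f1, c f2, c f3]" "{c f1, c f2, c f3} \<subseteq> {1, 2, 3}"
    using c facets by (auto simp: proper_3_coloring_def)
qed

lemma sum_facets_at_vertex:
  fixes g :: "nat \<Rightarrow> real"
  assumes P: "simple_3_polytope P" and c: "proper_3_coloring P c" and v: "v \<in> vertices P"
  shows "(\<Sum>f | f \<in> facets P \<and> v \<in> f. g (c f)) = g 1 + g 2 + g 3"
proof -
  obtain f1 f2 f3 w1 w2 w3 where "vertex_frame P v f1 f2 f3 w1 w2 w3"
    using vertex_frame_exists[OF P v] .
  then have star: "{f \<in> facets P. v \<in> f} = {f1, f2, f3}" and dist: "distinct [f1, f2, f3]"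
    by (auto simp: vertex_frame_def)
  have "g (c f1) + g (c f2) + g (c f3) = g 1 + g 2 + g 3"
    using colours_at_vertex[OF P c v star dist] by auto
  then show ?thesis unfolding star using dist by (simp add: add.assoc)
qed

lemma incidence_relation_iff_vertexwise:
  assumes P: "polytope P" and vtx: "bij_betw vtx UNIV (vertices P)"
  shows "(\<Sum>f\<in>facets P. l f *\<^sub>R incidence_vector vtx f) = 0
    \<longleftrightarrow> (\<forall>v\<in>vertices P. (\<Sum>f | f \<in> facets P \<and> v \<in> f. l f) = 0)"
proof -
  have comp: "(\<Sum>f\<in>facets P. l f *\<^sub>R incidence_vector vtx f) $ i
      = (\<Sum>f | f \<in> facets P \<and> vtx i \<in> f. l f)" for i
    using finite_facets[OF P]
    by (simp add: incidence_vector_def sum.If_cases if_distrib Int_def cong: if_cong)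
  have "vertices P = range vtx" using vtx by (simp add: bij_betw_def)
  then show ?thesis unfolding vec_eq_iff comp by simp
qed

text \<open>The common value \<open>a\<close> of each colour is read off at the highest vertex \<open>t\<close> and carried downwards:
  every other vertex \<open>v\<close> has a higher neighbour, which shares two facets with \<open>v\<close>, and the relation
  at \<open>v\<close> then determines the coefficient of the third facet.\<close>
lemma relation_constant_on_colours:
  assumes P: "simple_3_polytope P" and c: "proper_3_coloring P c"
    and rel: "\<And>v. v \<in> vertices P \<Longrightarrow> (\<Sum>f | f \<in> facets P \<and> v \<in> f. l f) = (0::real)"
  obtains a where "a 1 + a 2 + a 3 = (0::real)" "\<And>f. f \<in> facets P \<Longrightarrow> l f = a (c f)"
proof -
  have poly: "polytope P" "aff_dim P = 3" using P by (auto simp: simple_3_polytope_def)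
  obtain y where inj: "inj_on ((\<bullet>) y) (vertices P)"
    using generic_direction_on_vertices[OF poly(1)] .
  have "card {v \<in> vertices P. top_of y P v} = 1"
    using poly face_of_refl polytope_imp_convex inj by (intro card_top_vertices) auto
  then obtain t where t: "{v \<in> vertices P. top_of y P v} = {t}" by (auto simp: card_1_singleton_iff)
  then have tv: "t \<in> vertices P" by auto
  obtain f1 f2 f3 w1 w2 w3 where frame_t: "vertex_frame P t f1 f2 f3 w1 w2 w3"
    using vertex_frame_exists[OF P tv] .
  then have star_t: "{f \<in> facets P. t \<in> f} = {f1, f2, f3}" and dist_t: "distinct [f1, f2, f3]"
    by (auto simp: vertex_frame_def)
  have col: "c f1 \<noteq> c f2" "c f1 \<noteq> c f3" "c f2 \<noteq> c f3"
    using colours_at_vertex[OF P c tv star_t dist_t] by auto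
  define a where "a i = (if i = c f1 then l f1 else if i = c f2 then l f2 else l f3)" for i
  have a: "l f = a (c f)" if "f \<in> facets P" "t \<in> f" for f
  proof -
    have "f \<in> {f1, f2, f3}" using that star_t by auto
    then show ?thesis using col by (auto simp: a_def)
  qed
  have sum_a: "a 1 + a 2 + a 3 = 0"
  proof -
    have "a 1 + a 2 + a 3 = (\<Sum>f | f \<in> facets P \<and> t \<in> f. a (c f))"
      by (simp add: sum_facets_at_vertex[OF P c tv])
    also have "\<dots> = (\<Sum>f | f \<in> facets P \<and> t \<in> f. l f)" by (rule sum.cong) (auto simp: a)
    finally show ?thesis using rel[OF tv] by simp
  qed
  have step: "\<forall>f\<in>facets P. v \<in> f \<longrightarrow> l f = a (c f)"
    if frame: "vertex_frame P v f1 f2 f3 w1 w2 w3" and v: "v \<in> vertices P"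
      and w: "\<forall>f\<in>facets P. w1 \<in> f \<longrightarrow> l f = a (c f)"
    for v f1 f2 f3 w1 w2 w3
  proof -
    have star: "{f \<in> facets P. v \<in> f} = {f1, f2, f3}" and dist: "distinct [f1, f2, f3]"
      and "w1 \<in> f2" "w1 \<in> f3"
      using frame by (auto simp: vertex_frame_def)
    moreover have "f2 \<in> facets P" "f3 \<in> facets P" using star by auto
    ultimately have l: "l f2 = a (c f2)" "l f3 = a (c f3)" using w by auto
    have "l f1 + l f2 + l f3 = 0"
      using rel[OF v] dist unfolding star by simp
    moreover have "a (c f1) + a (c f2) + a (c f3) = 0"
      using sum_facets_at_vertex[OF P c v, of a] sum_a dist unfolding star by simp
    ultimately have "\<forall>f\<in>{f1, f2, f3}. l f = a (c f)" using l by auto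
    then show ?thesis unfolding star[symmetric] by blast
  qed
  have all: "\<forall>f\<in>facets P. v \<in> f \<longrightarrow> l f = a (c f)" if "v \<in> vertices P" for v
    using that
  proof (induction "card {u \<in> vertices P. y \<bullet> v < y \<bullet> u}" arbitrary: v rule: less_induct)
    case less
    have higher: "\<forall>f\<in>facets P. w \<in> f \<longrightarrow> l f = a (c f)"
      if w: "w \<in> vertices P" "y \<bullet> v < y \<bullet> w" for w
    proof (rule less.hyps[OF _ w(1)], rule psubset_card_mono)
      show "finite {u \<in> vertices P. y \<bullet> v < y \<bullet> u}" using finite_vertices[OF poly(1)] by simp
      show "{u \<in> vertices P. y \<bullet> w < y \<bullet> u} \<subset> {u \<in> vertices P. y \<bullet> v < y \<bullet> u}"
        using w by fastforce
    qed
    show ?case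
    proof (cases "v = t")
      case True
      then show ?thesis using a by blast
    next
      case False
      obtain f1 f2 f3 w1 w2 w3 where fr1: "vertex_frame P v f1 f2 f3 w1 w2 w3"
        using vertex_frame_exists[OF P less.prems] .
      note fr2 = vertex_frame_rotate[OF fr1]
      note fr3 = vertex_frame_rotate[OF fr2]
      have in_f: "v \<in> f1" "v \<in> f2" "v \<in> f3"
        using fr1 unfolding vertex_frame_def by blast+
      have w: "w1 \<in> vertices P" "w2 \<in> vertices P" "w3 \<in> vertices P" "w1 \<noteq> v" "w2 \<noteq> v" "w3 \<noteq> v"
        using fr1 in_f by (auto simp: vertex_frame_def)
      have "\<not> top_of y P v" using False t less.prems by auto
      then have "\<exists>w\<in>{w1, w2, w3}. \<not> y \<bullet> w < y \<bullet> v"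
        using top_of_frame(2)[OF fr1 less.prems inj] by auto
      moreover have "\<forall>w\<in>{w1, w2, w3}. y \<bullet> w \<noteq> y \<bullet> v"
        using inj w less.prems by (auto simp: inj_on_def)
      ultimately have "\<exists>w\<in>{w1, w2, w3}. y \<bullet> v < y \<bullet> w" by fastforce
      then show ?thesis
        using step[OF fr1 less.prems] step[OF fr2 less.prems] step[OF fr3 less.prems] higher w(1-3)
        by blast
    qed
  qed
  have "l f = a (c f)" if f: "f \<in> facets P" for f
  proof -
    have "card {v \<in> vertices P. top_of y f v} = 1"
      using f by (intro card_top_vertices[OF poly(1) _ _ inj]) (auto simp: facets_def facet_of_def)
    then have "{v \<in> vertices P. top_of y f v} \<noteq> {}" by (metis card.empty zero_neq_one)
    then obtain v where "v \<in> vertices P" "v \<in> f" by (auto simp: top_of_def)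
    then show ?thesis using all f by blast
  qed
  with sum_a show ?thesis by (rule that)
qed

lemma incidence_relation_iff_colourwise:
  assumes P: "simple_3_polytope P" and c: "proper_3_coloring P c"
    and vtx: "bij_betw vtx UNIV (vertices P)"
  shows "(\<Sum>f\<in>facets P. l f *\<^sub>R incidence_vector vtx f) = 0
    \<longleftrightarrow> (\<exists>a. a 1 + a 2 + a 3 = 0 \<and> (\<forall>f\<in>facets P. l f = a (c f)))" (is "?lhs \<longleftrightarrow> ?rhs")
proof -
  have poly: "polytope P" using P by (auto simp: simple_3_polytope_def)
  note iff = incidence_relation_iff_vertexwise[OF poly vtx]
  show ?thesis
  proof
    assume ?lhs
    then show ?rhs
      using relation_constant_on_colours[OF P c, of l] unfolding iff by metis
  next
    assume ?rhs
    then obtain a where a: "a 1 + a 2 + a 3 = 0" "\<forall>f\<in>facets P. l f = a (c f)" by blast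
    have "(\<Sum>f | f \<in> facets P \<and> v \<in> f. l f) = 0" if "v \<in> vertices P" for v
    proof -
      have "(\<Sum>f | f \<in> facets P \<and> v \<in> f. l f) = (\<Sum>f | f \<in> facets P \<and> v \<in> f. a (c f))"
        using a(2) by (intro sum.cong) auto
      then show ?thesis using sum_facets_at_vertex[OF P c that, of a] a(1) by simp
    qed
    then show ?lhs unfolding iff by blast
  qed
qed

text \<open>A facet is the convex hull of the vertices of \<open>P\<close> on it.\<close>
lemma inj_on_incidence_vector:
  assumes P: "polytope P" and vtx: "bij_betw vtx UNIV (vertices P)"
  shows "inj_on (incidence_vector vtx) (facets P)"
proof (rule inj_onI)
  have hull: "f = convex hull {v \<in> vertices P. v \<in> f}" if "f \<in> facets P" for f
  proof -
    have f: "f face_of P" using that facet_of_imp_face_of by (auto simp: facets_def)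
    then have "compact f" "convex f"
      using P face_of_polytope_polytope polytope_imp_compact polytope_imp_convex by blast+
    then have "f = convex hull {v. v extreme_point_of f}" by (rule Krein_Milman_Minkowski)
    then show ?thesis using extreme_point_of_face[OF f] by (simp add: vertices_def)
  qed
  fix f g assume fg: "f \<in> facets P" "g \<in> facets P"
    and "incidence_vector vtx f = incidence_vector vtx g"
  then have "vtx i \<in> f \<longleftrightarrow> vtx i \<in> g" for i
    by (auto simp: incidence_vector_def vec_eq_iff split: if_splits)
  moreover have "vertices P = range vtx" using vtx by (simp add: bij_betw_def)
  ultimately have "{v \<in> vertices P. v \<in> f} = {v \<in> vertices P. v \<in> g}" by auto
  then show "f = g" using hull[OF fg(1)] hull[OF fg(2)] by simp
qed

section \<open>The dimension\<close>

lemma sum_by_colour: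
  fixes a :: "nat \<Rightarrow> real"
  assumes P: "polytope P" and c: "proper_3_coloring P c"
  shows "(\<Sum>f\<in>facets P. a (c f)) =
    color_count P c 1 * a 1 + color_count P c 2 * a 2 + color_count P c 3 * a 3"
proof -
  have "(\<Sum>f\<in>facets P. a (c f)) = (\<Sum>i\<in>{1, 2, 3}. \<Sum>f | f \<in> facets P \<and> c f = i. a (c f))"
    using c finite_facets[OF P] by (intro sum.group[symmetric]) (auto simp: proper_3_coloring_def)
  also have "\<dots> = (\<Sum>i\<in>{1, 2, 3}. color_count P c i * a i)"
    by (intro sum.cong) (auto simp: color_count_def)
  finally show ?thesis by simp
qed

text \<open>A relation is determined by its coefficients at one facet \<open>g1\<close> of colour 1 and one facet \<open>g2\<close>
  of colour 2, and these can be prescribed. Hence the other facets give a basis of the span.\<close>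
lemma dim_incidence_vectors:
  assumes P: "simple_3_polytope P" and c: "proper_3_coloring P c"
    and vtx: "bij_betw vtx UNIV (vertices P)"
  shows "dim (incidence_vector vtx ` facets P) + 2 = card (facets P)"
proof -
  let ?\<xi> = "incidence_vector vtx"
  have poly: "polytope P" "aff_dim P = 3" using P by (auto simp: simple_3_polytope_def)
  note fin = finite_facets[OF poly(1)]
  have "vertices P \<noteq> {}" using vtx by (auto simp: bij_betw_def)
  then obtain v where v: "v \<in> vertices P" by auto
  have "\<exists>f. f \<in> facets P \<and> c f = i" if i: "i \<in> {1, 2, 3}" for i
  proof (rule ccontr)
    assume none: "\<not> ?thesis"
    have "(\<Sum>f | f \<in> facets P \<and> v \<in> f. of_bool (c f = i)) = (0::real)"
      using none by (intro sum.neutral) auto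
    then show False using sum_facets_at_vertex[OF P c v, of "\<lambda>j. of_bool (j = i)"] i by auto
  qed
  from this[of 1] this[of 2] obtain g1 g2 where g: "g1 \<in> facets P" "c g1 = 1" "g2 \<in> facets P" "c g2 = 2"
    by auto
  let ?B = "facets P - {g1, g2}"
  have split: "(\<Sum>f\<in>facets P. l f *\<^sub>R ?\<xi> f) = l g1 *\<^sub>R ?\<xi> g1 + l g2 *\<^sub>R ?\<xi> g2 + (\<Sum>f\<in>?B. l f *\<^sub>R ?\<xi> f)"
    for l :: "'a set \<Rightarrow> real"
  proof -
    have "facets P = insert g1 (insert g2 ?B)" "g1 \<noteq> g2" using g by auto
    then have "(\<Sum>f\<in>facets P. l f *\<^sub>R ?\<xi> f) = (\<Sum>f\<in>insert g1 (insert g2 ?B). l f *\<^sub>R ?\<xi> f)" by simp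
    then show ?thesis using fin \<open>g1 \<noteq> g2\<close> by (simp add: add.assoc)
  qed
  have inj: "inj_on ?\<xi> ?B"
    using inj_on_incidence_vector[OF poly(1) vtx] by (rule inj_on_subset) auto
  have "independent (?\<xi> ` ?B)"
  proof (rule independent_if_scalars_zero)
    fix u x assume "(\<Sum>x\<in>?\<xi> ` ?B. u x *\<^sub>R x) = 0" and x: "x \<in> ?\<xi> ` ?B"
    then have rel: "(\<Sum>f\<in>?B. u (?\<xi> f) *\<^sub>R ?\<xi> f) = 0" by (simp add: sum.reindex[OF inj])
    define l where "l f = (if f \<in> {g1, g2} then 0 else u (?\<xi> f))" for f
    have "(\<Sum>f\<in>?B. l f *\<^sub>R ?\<xi> f) = (\<Sum>f\<in>?B. u (?\<xi> f) *\<^sub>R ?\<xi> f)"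
      by (intro sum.cong) (auto simp: l_def)
    then have "(\<Sum>f\<in>facets P. l f *\<^sub>R ?\<xi> f) = 0" unfolding split using rel by (simp add: l_def)
    then obtain a where a: "a 1 + a 2 + a 3 = 0" "\<forall>f\<in>facets P. l f = a (c f)"
      unfolding incidence_relation_iff_colourwise[OF P c vtx] by blast
    have "a 1 = 0" "a 2 = 0"
      using bspec[OF a(2) g(1)] bspec[OF a(2) g(3)] g(2,4) by (simp_all add: l_def)
    then have a0: "a i = 0" if "i \<in> {1, 2, 3}" for i using a(1) that by auto
    obtain f where f: "f \<in> ?B" "x = ?\<xi> f" using x by blast
    have "c f \<in> {1, 2, 3}" using c f(1) unfolding proper_3_coloring_def by blast
    then have "l f = 0" using bspec[OF a(2), of f] f(1) a0[of "c f"] by simp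
    then show "u x = 0" using f by (simp add: l_def)
  qed (use fin in simp)
  moreover have "?\<xi> ` facets P \<subseteq> span (?\<xi> ` ?B)"
  proof -
    have in_span: "(\<Sum>f\<in>?B. l f *\<^sub>R ?\<xi> f) \<in> span (?\<xi> ` ?B)" for l
      by (intro span_sum span_scale span_base) auto
    have dep: "l g1 *\<^sub>R ?\<xi> g1 + l g2 *\<^sub>R ?\<xi> g2 \<in> span (?\<xi> ` ?B)"
      if "l = (\<lambda>f. a (c f))" "a 1 + a 2 + a 3 = 0" for a l
    proof -
      have "(\<Sum>f\<in>facets P. l f *\<^sub>R ?\<xi> f) = 0"
        unfolding incidence_relation_iff_colourwise[OF P c vtx] using that by blast
      then have "l g1 *\<^sub>R ?\<xi> g1 + l g2 *\<^sub>R ?\<xi> g2 = - (\<Sum>f\<in>?B. l f *\<^sub>R ?\<xi> f)"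
        unfolding split by (rule iffD2[OF eq_neg_iff_add_eq_0])
      then show ?thesis using span_neg[OF in_span[of l]] by (simp only:)
    qed
    \<comment> \<open>The colour values \<open>1, 0, -1\<close> isolate \<open>g1\<close>, and \<open>0, 1, -1\<close> isolate \<open>g2\<close>.\<close>
    have "?\<xi> g1 \<in> span (?\<xi> ` ?B)" "?\<xi> g2 \<in> span (?\<xi> ` ?B)"
      using dep[OF refl, of "\<lambda>i. if i = 1 then 1 else if i = 2 then 0 else -1"]
        dep[OF refl, of "\<lambda>i. if i = 1 then 0 else if i = 2 then 1 else -1"] g by simp_all
    then show ?thesis using span_base[of _ "?\<xi> ` ?B"] by blast
  qed
  ultimately have "dim (?\<xi> ` facets P) = card (?\<xi> ` ?B)"
    by (intro dim_unique[of "?\<xi> ` ?B"]) auto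
  also have "\<dots> = card ?B" by (rule card_image[OF inj])
  also have "\<dots> + 2 = card (facets P)"
  proof -
    have "g1 \<noteq> g2" using g by auto
    then have "card {g1, g2} = 2" "{g1, g2} \<subseteq> facets P" using g by auto
    then show ?thesis using fin card_mono[of "facets P" "{g1, g2}"] by (simp add: card_Diff_subset)
  qed
  finally show ?thesis .
qed

text \<open>The origin is an affine combination of the incidence vectors iff some relation has coefficient
  sum 1. If \<open>m\<^sub>1 \<noteq> m\<^sub>2\<close>, a multiple of the relation with colour values \<open>1, -1, 0\<close> does it, and if
  \<open>m\<^sub>2 \<noteq> m\<^sub>3\<close>, a multiple of the one with \<open>0, 1, -1\<close>.\<close>
lemma zero_in_affine_hull_incidence_vectors:
  assumes P: "simple_3_polytope P" and c: "proper_3_coloring P c"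
    and vtx: "bij_betw vtx UNIV (vertices P)"
  shows "0 \<in> affine hull (incidence_vector vtx ` facets P) \<longleftrightarrow>
    \<not> (color_count P c 1 = color_count P c 2 \<and> color_count P c 2 = color_count P c 3)"
proof -
  let ?\<xi> = "incidence_vector vtx"
  let ?m = "\<lambda>i. real (color_count P c i)"
  have poly: "polytope P" using P by (auto simp: simple_3_polytope_def)
  note fin = finite_facets[OF poly]
  note inj = inj_on_incidence_vector[OF poly vtx]
  have hull: "0 \<in> affine hull (?\<xi> ` facets P) \<longleftrightarrow>
    (\<exists>l. sum l (facets P) = 1 \<and> (\<Sum>f\<in>facets P. l f *\<^sub>R ?\<xi> f) = 0)" (is "_ \<longleftrightarrow> ?rhs")
  proof
    assume "0 \<in> affine hull (?\<xi> ` facets P)"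
    then obtain u where "sum u (?\<xi> ` facets P) = 1" "(\<Sum>x\<in>?\<xi> ` facets P. u x *\<^sub>R x) = 0"
      using fin by (auto simp: affine_hull_finite)
    then show ?rhs by (intro exI[of _ "u \<circ> ?\<xi>"]) (simp add: sum.reindex[OF inj])
  next
    assume ?rhs
    then obtain l where l: "sum l (facets P) = 1" "(\<Sum>f\<in>facets P. l f *\<^sub>R ?\<xi> f) = 0" by blast
    define u where "u x = l (inv_into (facets P) ?\<xi> x)" for x
    have "sum u (?\<xi> ` facets P) = 1" "(\<Sum>x\<in>?\<xi> ` facets P. u x *\<^sub>R x) = 0"
      using l by (simp_all add: sum.reindex[OF inj] u_def inv_into_f_f[OF inj] cong: sum.cong)
    then show "0 \<in> affine hull (?\<xi> ` facets P)" using fin by (auto simp: affine_hull_finite)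
  qed
  have "?rhs \<longleftrightarrow> (\<exists>a :: nat \<Rightarrow> real. a 1 + a 2 + a 3 = 0 \<and> ?m 1 * a 1 + ?m 2 * a 2 + ?m 3 * a 3 = 1)"
    (is "_ \<longleftrightarrow> ?colours")
  proof
    assume ?rhs
    then obtain l :: "'a set \<Rightarrow> real" and a
      where "sum l (facets P) = 1" "a 1 + a 2 + a 3 = 0" "\<forall>f\<in>facets P. l f = a (c f)"
      unfolding incidence_relation_iff_colourwise[OF P c vtx] by blast
    moreover from this have "sum l (facets P) = (\<Sum>f\<in>facets P. a (c f))" by (intro sum.cong) auto
    ultimately show ?colours unfolding sum_by_colour[OF poly c] by force
  next
    assume ?colours
    then obtain a :: "nat \<Rightarrow> real"
      where a: "a 1 + a 2 + a 3 = 0" "?m 1 * a 1 + ?m 2 * a 2 + ?m 3 * a 3 = 1" by blast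
    then show ?rhs
      unfolding incidence_relation_iff_colourwise[OF P c vtx]
      by (intro exI[of _ "\<lambda>f. a (c f)"]) (use sum_by_colour[OF poly c, of a] in auto)
  qed
  also have "\<dots> \<longleftrightarrow> \<not> (color_count P c 1 = color_count P c 2 \<and> color_count P c 2 = color_count P c 3)"
    (is "_ \<longleftrightarrow> \<not> ?equal")
  proof
    assume ?colours
    then obtain a :: "nat \<Rightarrow> real"
      where a: "a 1 + a 2 + a 3 = 0" "?m 1 * a 1 + ?m 2 * a 2 + ?m 3 * a 3 = 1" by blast
    show "\<not> ?equal"
    proof
      assume ?equal
      then have "?m 1 * a 1 + ?m 2 * a 2 + ?m 3 * a 3 = ?m 1 * (a 1 + a 2 + a 3)"
        by (simp add: algebra_simps)
      then show False using a by simp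
    qed
  next
    assume "\<not> ?equal"
    then consider "?m 1 - ?m 2 \<noteq> 0" | "?m 2 - ?m 3 \<noteq> 0" by auto
    then show ?colours
    proof cases
      case 1
      define d where "d = ?m 1 - ?m 2"
      then have "d \<noteq> 0" and m: "?m 1 = ?m 2 + d" using 1 by auto
      let ?a = "\<lambda>i::nat. (if i = 1 then 1 else if i = 2 then -1 else 0) / d"
      have "?a 1 + ?a 2 + ?a 3 = 0 \<and> ?m 1 * ?a 1 + ?m 2 * ?a 2 + ?m 3 * ?a 3 = 1"
        using \<open>d \<noteq> 0\<close> unfolding m by (simp add: field_simps)
      then show ?thesis by (rule exI[of _ ?a])
    next
      case 2
      define d where "d = ?m 2 - ?m 3"
      then have "d \<noteq> 0" and m: "?m 2 = ?m 3 + d" using 2 by auto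
      let ?a = "\<lambda>i::nat. (if i = 1 then 0 else if i = 2 then 1 else -1) / d"
      have "?a 1 + ?a 2 + ?a 3 = 0 \<and> ?m 1 * ?a 1 + ?m 2 * ?a 2 + ?m 3 * ?a 3 = 1"
        using \<open>d \<noteq> 0\<close> unfolding m by (simp add: field_simps)
      then show ?thesis by (rule exI[of _ ?a])
    qed
  qed
  finally show ?thesis using hull by blast
qed

theorem theorem2p1:
  fixes P :: "'a::euclidean_space set"
    and c :: "'a set \<Rightarrow> nat"
    and vtx :: "'v::finite \<Rightarrow> 'a"
    and n :: nat
  assumes "three_colorable_polytope P"
    and "card (vertices P) = 2 * n"
    and "bij_betw vtx (UNIV :: 'v set) (vertices P)"
    and "proper_3_coloring P c"
  shows "aff_dim (incidence_polytope P vtx) =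
           (if color_count P c 1 = color_count P c 2 \<and> color_count P c 2 = color_count P c 3
            then int n - 1 else int n)"
proof -
  let ?S = "incidence_vector vtx ` facets P"
  have P: "simple_3_polytope P" using assms(1) by (simp add: three_colorable_polytope_def)
  have "card (facets P) = n + 2"
    using card_facets_simple_3_polytope[OF P] assms(2) by simp
  then have "dim ?S = n" using dim_incidence_vectors[OF P assms(4,3)] by simp
  then have "aff_dim (insert 0 ?S) = int n"
    by (simp add: aff_dim_zero hull_inc dim_insert span_zero)
  then have "aff_dim ?S = (if 0 \<in> affine hull ?S then int n else int n - 1)"
    by (auto simp: aff_dim_insert split: if_splits)
  then show ?thesis
    unfolding incidence_polytope_def aff_dim_convex_hull
      zero_in_affine_hull_incidence_vectors[OF P assms(4,3)] by simp
qed

end
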